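(* Let $\theta\in(0,1)$ be an irrational number of finite type (i.e. its continued fraction partial quotients are bounded). Then for every $x\in[0,1)$ we have $\rho_n(x)\sim\log n$, meaning that the ratio $\rho_n(x)/\log n$ ($n\ge2$) is bounded away from both zero and infinity.
   Context: Let $f=\chi_{[0,1/2)}-\chi_{[1/2,1)}$ on $[0,1)$ (addition modulo one). Put $S_n(x)=\sum_{i=0}^{n-1}f(x+i\theta)$, and for $n\ge2$ put $M_n(x)=\max\{S_i(x):i=1,\dots,n-1\}$, $m_n(x)=\min\{S_i(x):i=1,\dots,n-1\}$, and $\rho_n(x)=M_n(x)-m_n(x)+1$. *)

theory Defs
  imports Complex_Main "HOL-Library.Indicator_Function"
begin

text \<open>Simple continued fraction expansion of a real number, only meaningful for irrational
  arguments: for rational ones the algorithm should stop, whereas here it continues with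
  \<open>1 / 0 = 0\<close>.\<close>

primrec complete_quotient :: "real \<Rightarrow> nat \<Rightarrow> real" where
  "complete_quotient \<theta> 0 = \<theta>"
| "complete_quotient \<theta> (Suc k) = 1 / frac (complete_quotient \<theta> k)"

definition partial_quotient :: "real \<Rightarrow> nat \<Rightarrow> int" where
  "partial_quotient \<theta> k = \<lfloor>complete_quotient \<theta> k\<rfloor>"

definition finite_type :: "real \<Rightarrow> bool" where
  "finite_type \<theta> \<longleftrightarrow> \<theta> \<notin> \<rat> \<and> bdd_above (range (partial_quotient \<theta>))"

text \<open>Addition modulo one is implemented by evaluating at the fractional part, i.e. the function
  on \<open>[0, 1)\<close> is extended to the reals with period one.\<close>

definition f_half :: "real \<Rightarrow> real" where
  "f_half x = indicator {0..<1/2} (frac x) - indicator {1/2..<1} (frac x)"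

definition S :: "real \<Rightarrow> nat \<Rightarrow> real \<Rightarrow> real" where
  "S \<theta> n x = (\<Sum>i<n. f_half (x + real i * \<theta>))"

text \<open>The next three are only meaningful for \<open>n \<ge> 2\<close>, where the set of indices is nonempty.\<close>

definition M_max :: "real \<Rightarrow> nat \<Rightarrow> real \<Rightarrow> real" where
  "M_max \<theta> n x = Max ((\<lambda>i. S \<theta> i x) ` {1..n - 1})"

definition m_min :: "real \<Rightarrow> nat \<Rightarrow> real \<Rightarrow> real" where
  "m_min \<theta> n x = Min ((\<lambda>i. S \<theta> i x) ` {1..n - 1})"

definition \<rho> :: "real \<Rightarrow> nat \<Rightarrow> real \<Rightarrow> real" where
  "\<rho> \<theta> n x = M_max \<theta> n x - m_min \<theta> n x + 1"

end

(* Finite type gives |m theta - p| >= c / m, and odd denominators q with ||q theta|| < c / (16 N)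
   and q = O(N).

   Lower bound. Suppose that every N consecutive sums have range at least R, but S_0, ..., S_(2N+q)
   have range exactly R. Then every window of N + 1 indices contains a global maximum. If f takes the
   same values along x + (a + l) theta and x + (a + q + l) theta for l < N, the windows starting at
   a and a + q are translates of each other, so comparing their maxima gives S_a = S_(a+q), which
   contradicts the oddness of q. Hence both for a = 0 and for a = N some x + (a + l) theta is within
   ||q theta|| of a discontinuity of f; subtracting, ||2 m theta|| < c / (4 N) for some 0 < m < 2 N,
   a contradiction. So multiplying N by a constant raises the minimal range by one.

   Upper bound. S_q is uniformly bounded when q is a convergent denominator, and peeling off the
   largest such q <= n leaves at most a fixed proportion of n. *)

theory Submission
  imports Defs "HOL-Number_Theory.Cong"
begin

section \<open>Convergents of a continued fraction: denominators, errors, best approximation\<close>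

section \<open>Convergents\<close>

text \<open>Indices are shifted by one: \<open>conv_den \<theta> (Suc k)\<close> is the usual q_k,
  and index 0 holds the conventional q_{-1} = 0. Likewise \<open>conv_num\<close> starts with p_{-1}
  = 1.\<close>

fun conv_den :: "real \<Rightarrow> nat \<Rightarrow> int" where
  "conv_den \<theta> 0 = 0"
| "conv_den \<theta> (Suc 0) = 1"
| "conv_den \<theta> (Suc (Suc k)) = partial_quotient \<theta> (Suc k) * conv_den \<theta> (Suc k) + conv_den \<theta> k"

fun conv_num :: "real \<Rightarrow> nat \<Rightarrow> int" where
  "conv_num \<theta> 0 = 1"
| "conv_num \<theta> (Suc 0) = partial_quotient \<theta> 0"
| "conv_num \<theta> (Suc (Suc k)) = partial_quotient \<theta> (Suc k) * conv_num \<theta> (Suc k) + conv_num \<theta> k"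

text \<open>The differences q \<theta> - p alternate in sign along the convergents of an irrational
  number; the sign factor turns them into their absolute values, see
  \<open>abs_conv_err\<close>.\<close>

definition conv_err :: "real \<Rightarrow> nat \<Rightarrow> real" where
  "conv_err \<theta> k = (-1) ^ Suc k * (of_int (conv_den \<theta> k) * \<theta> - of_int (conv_num \<theta> k))"

declare conv_den.simps(3) [simp del] conv_num.simps(3) [simp del] complete_quotient.simps(2) [simp del]

lemma complete_quotient_irrational:
  assumes "\<theta> \<notin> \<rat>"
  shows "complete_quotient \<theta> k \<notin> \<rat>"
proof (induction k)
  case (Suc k)
  have "frac (complete_quotient \<theta> k) \<notin> \<rat>"
    using Suc by (metis Rats_add Rats_of_int frac_def diff_add_cancel)
  then show ?case
    using Rats_inverse by (fastforce simp: divide_inverse complete_quotient.simps(2))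
qed (use assms in simp)

lemma frac_complete_quotient_pos:
  assumes "\<theta> \<notin> \<rat>"
  shows "0 < frac (complete_quotient \<theta> k)"
  using complete_quotient_irrational[OF assms, of k] Ints_subset_Rats by (auto simp: frac_gt_0_iff)

lemma partial_quotient_Suc_ge_1:
  assumes "\<theta> \<notin> \<rat>"
  shows "1 \<le> partial_quotient \<theta> (Suc k)"
proof -
  have "1 \<le> 1 / frac (complete_quotient \<theta> k)"
    using frac_complete_quotient_pos[OF assms, of k] frac_lt_1[of "complete_quotient \<theta> k"] by simp
  then show ?thesis by (simp add: partial_quotient_def complete_quotient.simps(2))
qed

lemma conv_den_pos:
  assumes "\<theta> \<notin> \<rat>"
  shows "1 \<le> conv_den \<theta> (Suc k)"
proof -
  have "1 \<le> conv_den \<theta> (Suc k) \<and> 0 \<le> conv_den \<theta> k"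
  proof (induction k)
    case (Suc k)
    have "1 * conv_den \<theta> (Suc k) \<le> partial_quotient \<theta> (Suc k) * conv_den \<theta> (Suc k)"
      using Suc partial_quotient_Suc_ge_1[OF assms, of k] by (intro mult_right_mono) auto
    then show ?case using Suc unfolding conv_den.simps by linarith
  qed simp
  then show ?thesis ..
qed

lemma conv_den_nonneg:
  assumes "\<theta> \<notin> \<rat>"
  shows "0 \<le> conv_den \<theta> k"
  using conv_den_pos[OF assms, of "k - 1"] by (cases k) auto

lemma conv_den_Suc_Suc_ge:
  assumes "\<theta> \<notin> \<rat>"
  shows "conv_den \<theta> (Suc k) + conv_den \<theta> k \<le> conv_den \<theta> (Suc (Suc k))"
proof -
  have "1 * conv_den \<theta> (Suc k) \<le> partial_quotient \<theta> (Suc k) * conv_den \<theta> (Suc k)"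
    using conv_den_pos[OF assms, of k] partial_quotient_Suc_ge_1[OF assms, of k]
    by (intro mult_right_mono) auto
  then show ?thesis unfolding conv_den.simps by linarith
qed

lemma conv_den_le_Suc:
  assumes "\<theta> \<notin> \<rat>"
  shows "conv_den \<theta> k \<le> conv_den \<theta> (Suc k)"
  using conv_den_Suc_Suc_ge[OF assms] conv_den_nonneg[OF assms]
  by (cases k) (simp, smt (verit))

text \<open>Crude, but it makes the denominators unbounded, which \<open>conv_den_bracket\<close>
  relies on.\<close>

lemma conv_den_ge:
  assumes "\<theta> \<notin> \<rat>"
  shows "int k \<le> conv_den \<theta> (Suc k)"
proof (induction k)
  case (Suc k)
  show ?case
  proof (cases k)
    case 0
    then show ?thesis using conv_den_pos[OF assms, of 1] by simp
  next
    case (Suc l)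
    then show ?thesis
      using Suc.IH conv_den_Suc_Suc_ge[OF assms, of k] conv_den_pos[OF assms, of l] by simp
  qed
qed simp

text \<open>In one step of the recurrence the terms with the partial quotient cancel, so the
  determinant only changes its sign.\<close>

lemma conv_det: "conv_num \<theta> k * conv_den \<theta> (Suc k) - conv_num \<theta> (Suc k) * conv_den \<theta> k = (-1) ^ k"
  by (induction k) (auto simp: algebra_simps conv_den.simps(3) conv_num.simps(3))

lemma coprime_conv: "coprime (conv_num \<theta> k) (conv_den \<theta> k)"
proof (rule coprimeI)
  fix d assume "d dvd conv_num \<theta> k" "d dvd conv_den \<theta> k"
  then have "d dvd conv_num \<theta> k * conv_den \<theta> (Suc k) - conv_num \<theta> (Suc k) * conv_den \<theta> k"
    by simp
  then have "d dvd (-1) ^ k" by (simp only: conv_det)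
  then show "is_unit d"
    by (metis dvd_trans is_unit_power_iff minus_dvd_iff one_dvd)
qed

text \<open>By induction, \<open>complete_quotient \<theta> (Suc k)\<close> is the ratio of the
  errors at \<open>k\<close> and \<open>Suc k\<close>. The recurrence subtracts its integer part
  times the later error, which leaves the fractional part.\<close>

lemma conv_err_Suc:
  assumes "\<theta> \<notin> \<rat>"
  shows "conv_err \<theta> (Suc k) = frac (complete_quotient \<theta> k) * conv_err \<theta> k"
proof (induction k)
  case 0
  show ?case by (simp add: conv_err_def frac_def partial_quotient_def)
next
  case (Suc k)
  let ?a = "complete_quotient \<theta> (Suc k)"
  have "?a * frac (complete_quotient \<theta> k) = 1"
    using frac_complete_quotient_pos[OF assms, of k] by (simp add: complete_quotient.simps(2))
  then have prev: "conv_err \<theta> k = ?a * conv_err \<theta> (Suc k)"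
    using Suc.IH by (metis mult.assoc mult_1)
  have "conv_err \<theta> (Suc (Suc k)) = conv_err \<theta> k - of_int \<lfloor>?a\<rfloor> * conv_err \<theta> (Suc k)"
    unfolding conv_err_def partial_quotient_def conv_den.simps conv_num.simps
    by (simp add: algebra_simps)
  also have "\<dots> = frac ?a * conv_err \<theta> (Suc k)"
    unfolding prev frac_def by (simp add: algebra_simps)
  finally show ?case .
qed

lemma conv_err_pos:
  assumes "\<theta> \<notin> \<rat>"
  shows "0 < conv_err \<theta> k"
proof (induction k)
  case 0
  show ?case by (simp add: conv_err_def)
next
  case (Suc k)
  then show ?case unfolding conv_err_Suc[OF assms]
    by (intro mult_pos_pos frac_complete_quotient_pos assms)
qed

lemma abs_conv_err:
  assumes "\<theta> \<notin> \<rat>"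
  shows "\<bar>of_int (conv_den \<theta> k) * \<theta> - of_int (conv_num \<theta> k)\<bar> = conv_err \<theta> k"
proof -
  have "\<bar>of_int (conv_den \<theta> k) * \<theta> - of_int (conv_num \<theta> k)\<bar> = \<bar>conv_err \<theta> k\<bar>"
    by (simp add: conv_err_def abs_mult)
  then show ?thesis using conv_err_pos[OF assms, of k] by simp
qed

lemma conv_err_le_Suc:
  assumes "\<theta> \<notin> \<rat>"
  shows "conv_err \<theta> (Suc k) \<le> conv_err \<theta> k"
  using conv_err_pos[OF assms, of k] frac_lt_1[of "complete_quotient \<theta> k"]
  by (simp add: conv_err_Suc[OF assms] mult_le_cancel_right2)

text \<open>Consecutive errors carry opposite signs, so the terms with \<theta> cancel and only the
  determinant remains.\<close>

lemma conv_err_identity: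
  "conv_err \<theta> k * of_int (conv_den \<theta> (Suc k)) + conv_err \<theta> (Suc k) * of_int (conv_den \<theta> k) = 1"
proof -
  have "conv_err \<theta> k * of_int (conv_den \<theta> (Suc k)) + conv_err \<theta> (Suc k) * of_int (conv_den \<theta> k)
    = (-1) ^ k * of_int (conv_num \<theta> k * conv_den \<theta> (Suc k) - conv_num \<theta> (Suc k) * conv_den \<theta> k)"
    unfolding conv_err_def by (simp add: algebra_simps)
  also have "\<dots> = (-1) ^ k * (-1) ^ k"
    unfolding conv_det by simp
  finally show ?thesis by (simp flip: power_mult_distrib)
qed

lemma conv_err_upper:
  assumes "\<theta> \<notin> \<rat>"
  shows "conv_err \<theta> k \<le> 1 / of_int (conv_den \<theta> (Suc k))"
proof -
  have "0 \<le> conv_err \<theta> (Suc k) * of_int (conv_den \<theta> k)"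
    using conv_err_pos[OF assms] conv_den_nonneg[OF assms, of k] by (simp add: less_imp_le)
  then have "conv_err \<theta> k * of_int (conv_den \<theta> (Suc k)) \<le> 1"
    using conv_err_identity[of \<theta> k] by linarith
  then show ?thesis
    using conv_den_pos[OF assms, of k] by (simp add: field_simps)
qed

text \<open>Of the two summands in \<open>conv_err_identity\<close>, the first has both the larger
  error and the larger denominator, so it is at least 1/2.\<close>

lemma conv_err_lower:
  assumes "\<theta> \<notin> \<rat>"
  shows "1 / (2 * of_int (conv_den \<theta> (Suc k))) \<le> conv_err \<theta> k"
proof -
  have "conv_err \<theta> (Suc k) * of_int (conv_den \<theta> k) \<le> conv_err \<theta> k * of_int (conv_den \<theta> (Suc k))"
    using conv_err_pos[OF assms, of k] conv_den_nonneg[OF assms, of k]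
      conv_err_le_Suc[OF assms, of k] conv_den_le_Suc[OF assms, of k]
    by (intro mult_mono) (auto simp: less_imp_le)
  then have "1 \<le> 2 * (conv_err \<theta> k * of_int (conv_den \<theta> (Suc k)))"
    using conv_err_identity[of \<theta> k] by linarith
  then show ?thesis
    using conv_den_pos[OF assms, of k] by (simp add: field_simps)
qed

text \<open>Two consecutive convergents form a basis of the integer lattice. In this basis the
  bounds on \<open>m\<close> force coefficients of opposite sign; as the errors alternate too, the
  two contributions to m \<theta> - p reinforce each other.\<close>

lemma conv_best_approximation:
  fixes m p :: int
  assumes irr: "\<theta> \<notin> \<rat>" and m: "0 < m" "m < conv_den \<theta> (Suc k)"
  shows "conv_err \<theta> k \<le> \<bar>of_int m * \<theta> - of_int p\<bar>"
proof -
  define s :: int where "s = (-1) ^ k"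
  have ss: "s * s = 1" by (simp add: s_def flip: power_mult_distrib)
  let ?q = "conv_den \<theta> k" and ?q' = "conv_den \<theta> (Suc k)"
  let ?p = "conv_num \<theta> k" and ?p' = "conv_num \<theta> (Suc k)"
  have det: "?p * ?q' - ?p' * ?q = s" unfolding s_def by (rule conv_det)
  \<comment> \<open>Cramer's rule; the determinant \<open>s\<close> is its own inverse.\<close>
  define u where "u = s * (p * ?q' - m * ?p')"
  define v where "v = s * (m * ?p - p * ?q)"
  have mq: "m = u * ?q + v * ?q'"
  proof -
    have "u * ?q + v * ?q' = s * (m * (?p * ?q' - ?p' * ?q))"
      unfolding u_def v_def by (simp add: algebra_simps)
    also have "\<dots> = m" unfolding det using ss by (metis mult.commute mult.left_commute mult_1)
    finally show ?thesis by simp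
  qed
  have pq: "p = u * ?p + v * ?p'"
  proof -
    have "u * ?p + v * ?p' = s * (p * (?p * ?q' - ?p' * ?q))"
      unfolding u_def v_def by (simp add: algebra_simps)
    also have "\<dots> = p" unfolding det using ss by (metis mult.commute mult.left_commute mult_1)
    finally show ?thesis by simp
  qed
  have q0: "0 \<le> ?q" "1 \<le> ?q'" by (rule conv_den_nonneg[OF irr], rule conv_den_pos[OF irr])
  have u0: "u \<noteq> 0"
  proof
    assume "u = 0"
    then have mv: "m = v * ?q'" using mq by simp
    then have "0 < v" using m(1) q0 by (simp add: zero_less_mult_iff)
    then have "1 * ?q' \<le> v * ?q'" using q0 by (intro mult_right_mono) auto
    then show False using mv m by linarith
  qed
  \<comment> \<open>Two positive coefficients would make \<open>m\<close> at least
    \<open>?q'\<close>, two negative ones would make it nonpositive.\<close>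
  have opp: "0 < u \<and> v \<le> 0 \<or> u < 0 \<and> 0 \<le> v"
  proof (rule ccontr)
    assume "\<not> ?thesis"
    then consider "0 < u" "1 \<le> v" | "u < 0" "v \<le> -1" using u0 by linarith
    then show False
    proof cases
      case 1
      then have "1 * ?q' \<le> v * ?q'" "0 \<le> u * ?q"
        using q0 by (intro mult_right_mono mult_nonneg_nonneg; simp)+
      then show False using mq m by linarith
    next
      case 2
      then have "v * ?q' \<le> 0" "u * ?q \<le> 0" using q0 by (auto simp: mult_le_0_iff)
      then show False using mq m by simp
    qed
  qed
  let ?e = "conv_err \<theta> k" and ?e' = "conv_err \<theta> (Suc k)"
  have e0: "0 < ?e" "0 < ?e'" using conv_err_pos[OF irr] by auto
  have sr: "of_int s * of_int s = (1::real)" using ss by (metis of_int_1 of_int_mult)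
  have "of_int m * \<theta> - of_int p
    = of_int u * (of_int ?q * \<theta> - of_int ?p) + of_int v * (of_int ?q' * \<theta> - of_int ?p')"
    by (subst mq, subst pq) (simp add: algebra_simps)
  also have "of_int ?q * \<theta> - of_int ?p = - of_int s * ?e"
    using sr unfolding conv_err_def s_def by simp
  also have "of_int ?q' * \<theta> - of_int ?p' = of_int s * ?e'"
    using sr unfolding conv_err_def s_def by simp
  finally have "of_int m * \<theta> - of_int p = of_int s * (of_int v * ?e' - of_int u * ?e)"
    by (simp add: algebra_simps)
  then have *: "\<bar>of_int m * \<theta> - of_int p\<bar> = \<bar>of_int v * ?e' - of_int u * ?e\<bar>"
    by (simp add: abs_mult s_def)
  from opp show ?thesis
  proof
    assume uv: "0 < u \<and> v \<le> 0"
    then have "of_int v * ?e' \<le> 0" "1 * ?e \<le> of_int u * ?e"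
      using e0 by (simp add: mult_le_0_iff, intro mult_right_mono) auto
    then show ?thesis unfolding * by linarith
  next
    assume uv: "u < 0 \<and> 0 \<le> v"
    then have "0 \<le> of_int v * ?e'" "1 * ?e \<le> of_int (- u) * ?e"
      using e0 by (auto intro!: mult_right_mono simp del: of_int_minus)
    then show ?thesis unfolding * by simp
  qed
qed

lemma conv_den_bracket:
  fixes X :: real
  assumes "\<theta> \<notin> \<rat>" and "1 \<le> X"
  obtains k where "of_int (conv_den \<theta> (Suc k)) \<le> X" and "X < of_int (conv_den \<theta> (Suc (Suc k)))"
proof -
  let ?P = "\<lambda>k. X < of_int (conv_den \<theta> (Suc k))"
  obtain n where "X < real n" using reals_Archimedean2 by blast
  also have "real n \<le> of_int (conv_den \<theta> (Suc n))"
    using conv_den_ge[OF assms(1), of n] by linarith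
  finally have n: "?P n" .
  have "\<not> ?P 0" using assms by simp
  then obtain k where "\<not> ?P k" "?P (Suc k)"
    using n nat_induct[of "\<lambda>k. \<not> ?P k" n] by blast
  then show ?thesis using that[of k] by simp
qed

section \<open>Diophantine properties of numbers of finite type\<close>

section \<open>Bounded partial quotients\<close>

text \<open>If A bounds the partial quotients, the recurrence and monotonicity give the factor A +
  1.\<close>

lemma conv_den_growth:
  assumes "finite_type \<theta>"
  obtains B :: real where "2 \<le> B"
    and "\<And>k. of_int (conv_den \<theta> (Suc (Suc k))) \<le> B * of_int (conv_den \<theta> (Suc k))"
proof -
  from assms have irr: "\<theta> \<notin> \<rat>" and "bdd_above (range (partial_quotient \<theta>))"
    by (auto simp: finite_type_def)
  then obtain A where A: "\<And>k. partial_quotient \<theta> k \<le> A"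
    by (auto simp: bdd_above_def)
  have A1: "1 \<le> A" using A[of 1] partial_quotient_Suc_ge_1[OF irr, of 0] by simp
  have "conv_den \<theta> (Suc (Suc k)) \<le> (A + 1) * conv_den \<theta> (Suc k)" for k
  proof -
    have "partial_quotient \<theta> (Suc k) * conv_den \<theta> (Suc k) \<le> A * conv_den \<theta> (Suc k)"
      using A conv_den_pos[OF irr, of k] by (intro mult_right_mono) auto
    then show ?thesis using conv_den_le_Suc[OF irr, of k]
      by (simp add: algebra_simps conv_den.simps(3))
  qed
  then have "real_of_int (conv_den \<theta> (Suc (Suc k))) \<le> of_int ((A + 1) * conv_den \<theta> (Suc k))" for k
    by (simp only: of_int_le_iff)
  then show ?thesis using that[of "of_int (A + 1)"] A1 by simp
qed

text \<open>For \<open>m\<close> between two consecutive denominators, the error of the smaller one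
  is a lower bound. It is comparable to the inverse of the larger one, which is at most B m.\<close>

lemma badly_approximable:
  assumes "finite_type \<theta>"
  obtains c :: real where "0 < c"
    and "\<And>(m::int) (p::int). 0 < m \<Longrightarrow> c / of_int m \<le> \<bar>of_int m * \<theta> - of_int p\<bar>"
proof -
  have irr: "\<theta> \<notin> \<rat>" using assms by (simp add: finite_type_def)
  obtain B :: real where B: "2 \<le> B"
    "\<And>k. of_int (conv_den \<theta> (Suc (Suc k))) \<le> B * of_int (conv_den \<theta> (Suc k))"
    using conv_den_growth[OF assms] by blast
  have "(1 / (2 * B)) / of_int m \<le> \<bar>of_int m * \<theta> - of_int p\<bar>" if m: "0 < m" for m p :: int
  proof -
    have "1 \<le> real_of_int m" using m by linarith
    then obtain k where k: "real_of_int (conv_den \<theta> (Suc k)) \<le> of_int m"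
        "real_of_int m < of_int (conv_den \<theta> (Suc (Suc k)))"
      using conv_den_bracket[OF irr] by blast
    let ?Q = "real_of_int (conv_den \<theta> (Suc (Suc k)))"
    have "?Q \<le> B * of_int (conv_den \<theta> (Suc k))" by (rule B)
    also have "\<dots> \<le> B * of_int m" using k B by (intro mult_left_mono) auto
    finally have "2 * ?Q \<le> 2 * B * of_int m" by simp
    moreover have "0 < ?Q" using conv_den_pos[OF irr, of "Suc k"] by linarith
    ultimately have "1 / (2 * B * of_int m) \<le> 1 / (2 * ?Q)"
      by (intro divide_left_mono) (use m B in auto)
    also have "\<dots> \<le> conv_err \<theta> (Suc k)" by (rule conv_err_lower[OF irr])
    also have "\<dots> \<le> \<bar>of_int m * \<theta> - of_int p\<bar>"
      using conv_best_approximation[OF irr m] k by simp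
    finally show ?thesis by simp
  qed
  then show ?thesis using that[of "1 / (2 * B)"] B by simp
qed

text \<open>Two consecutive denominators are coprime, so one of them is odd.\<close>

lemma odd_denominator:
  assumes "finite_type \<theta>"
  obtains C :: real where "0 < C"
    and "\<And>X. 1 \<le> X \<Longrightarrow> \<exists>q p. odd q \<and> 0 < q \<and> of_int q \<le> C * X \<and> \<bar>of_int q * \<theta> - of_int p\<bar> < 1 / X"
proof -
  have irr: "\<theta> \<notin> \<rat>" using assms by (simp add: finite_type_def)
  obtain B :: real where B: "2 \<le> B"
    "\<And>k. of_int (conv_den \<theta> (Suc (Suc k))) \<le> B * of_int (conv_den \<theta> (Suc k))"
    using conv_den_growth[OF assms] by blast
  have "\<exists>q p. odd q \<and> 0 < q \<and> of_int q \<le> B * B * X \<and> \<bar>of_int q * \<theta> - of_int p\<bar> < 1 / X"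
    if X: "1 \<le> X" for X
  proof -
    obtain k where k: "of_int (conv_den \<theta> (Suc k)) \<le> X" "X < of_int (conv_den \<theta> (Suc (Suc k)))"
      using conv_den_bracket[OF irr X] .
    let ?q = "\<lambda>i. conv_den \<theta> i"
    \<comment> \<open>The candidates are the first two denominators above \<open>X\<close>; reaching
      them costs one and two growth factors, hence the constant B * B.\<close>
    have le1: "real_of_int (?q (Suc (Suc k))) \<le> B * X"
      using B(2)[of k] mult_left_mono[OF k(1), of B] B(1) by linarith
    have le2: "real_of_int (?q (Suc (Suc (Suc k)))) \<le> B * B * X"
      using B(2)[of "Suc k"] mult_left_mono[OF le1, of B] B(1) by (simp only: mult.assoc) linarith
    have err: "conv_err \<theta> (Suc (Suc k)) < 1 / X"
    proof -
      have "X < of_int (?q (Suc (Suc (Suc k))))"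
        using k(2) conv_den_le_Suc[OF irr, of "Suc (Suc k)"] by linarith
      then have "1 / of_int (?q (Suc (Suc (Suc k)))) < 1 / X"
        using X by (intro divide_strict_left_mono) auto
      then show ?thesis using conv_err_upper[OF irr, of "Suc (Suc k)"] by linarith
    qed
    have "\<not> (even (?q (Suc (Suc k))) \<and> even (?q (Suc (Suc (Suc k)))))"
    proof
      assume "even (?q (Suc (Suc k))) \<and> even (?q (Suc (Suc (Suc k))))"
      then have "even (conv_num \<theta> (Suc (Suc k)) * ?q (Suc (Suc (Suc k)))
          - conv_num \<theta> (Suc (Suc (Suc k))) * ?q (Suc (Suc k)))"
        by simp
      then show False unfolding conv_det by simp
    qed
    then obtain i where i: "i = Suc (Suc k) \<or> i = Suc (Suc (Suc k))" "odd (?q i)" by blast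
    have "real_of_int (?q i) \<le> B * B * X"
      using i(1) le2 conv_den_le_Suc[OF irr, of "Suc (Suc k)"] by auto
    moreover have "conv_err \<theta> i < 1 / X"
      using i(1) err conv_err_le_Suc[OF irr, of "Suc (Suc k)"] by auto
    moreover have "0 < ?q i" using i(1) conv_den_pos[OF irr] by (auto simp: int_one_le_iff_zero_less)
    ultimately show ?thesis using i(2) abs_conv_err[OF irr, of i] by metis
  qed
  then show ?thesis using that[of "B * B"] B by simp
qed

section \<open>Jumps of f; cocycle identity, symmetries and parity of the sums\<close>

section \<open>The walk\<close>

text \<open>In this form the period is invisible and the discontinuities are exactly the points
  where 2 x is an integer.\<close>

lemma f_half_floor: "f_half x = (if even \<lfloor>2 * x\<rfloor> then 1 else -1)"
proof -
  have "2 * x = 2 * frac x + of_int (2 * \<lfloor>x\<rfloor>)" by (simp add: frac_def)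
  then have fl: "\<lfloor>2 * x\<rfloor> = \<lfloor>2 * frac x\<rfloor> + 2 * \<lfloor>x\<rfloor>" by (simp only: floor_add_int)
  have "0 \<le> frac x" "frac x < 1" by (simp_all add: frac_lt_1)
  then have "\<lfloor>2 * frac x\<rfloor> = (if frac x < 1/2 then 0 else 1)"
    by (auto simp: floor_eq_iff)
  then show ?thesis unfolding f_half_def fl using \<open>0 \<le> frac x\<close> \<open>frac x < 1\<close>
    by (auto simp: indicator_def)
qed

lemma f_half_add_int: "f_half (x + of_int p) = f_half x"
proof -
  have "2 * (x + of_int p) = 2 * x + of_int (2 * p)" by simp
  then have "\<lfloor>2 * (x + of_int p)\<rfloor> = \<lfloor>2 * x\<rfloor> + 2 * p" by (simp only: floor_add_int)
  then show ?thesis by (simp add: f_half_floor)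
qed

lemma f_half_add_half: "f_half (x + 1/2) = - f_half x"
proof -
  have "\<lfloor>2 * (x + 1/2)\<rfloor> = \<lfloor>2 * x\<rfloor> + 1" by (simp add: distrib_left)
  then show ?thesis by (simp add: f_half_floor)
qed

text \<open>A change of sign requires an integer between 2 u and 2 (u + d).\<close>

lemma f_half_neq_imp_near:
  assumes "f_half u \<noteq> f_half (u + d)"
  obtains a :: int where "\<bar>2 * u - of_int a\<bar> \<le> 2 * \<bar>d\<bar>"
proof -
  have ne: "\<lfloor>2 * u\<rfloor> \<noteq> \<lfloor>2 * (u + d)\<rfloor>"
    using assms by (auto simp: f_half_floor)
  show ?thesis
  proof (cases "0 \<le> d")
    case True
    then have "\<lfloor>2 * u\<rfloor> \<le> \<lfloor>2 * (u + d)\<rfloor>" by (intro floor_mono) simp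
    with ne have "\<lfloor>2 * u\<rfloor> + 1 \<le> \<lfloor>2 * (u + d)\<rfloor>" by linarith
    then have "of_int (\<lfloor>2 * u\<rfloor> + 1) \<le> 2 * (u + d)" by (simp only: le_floor_iff)
    then have "\<bar>2 * u - of_int (\<lfloor>2 * u\<rfloor> + 1)\<bar> \<le> 2 * \<bar>d\<bar>"
      using True floor_correct[of "2 * u"] by (simp add: abs_if)
    then show ?thesis by (rule that)
  next
    case False
    then have "\<lfloor>2 * (u + d)\<rfloor> \<le> \<lfloor>2 * u\<rfloor>" by (intro floor_mono) simp
    with ne have "\<lfloor>2 * (u + d)\<rfloor> < \<lfloor>2 * u\<rfloor>" by linarith
    then have "2 * (u + d) < of_int \<lfloor>2 * u\<rfloor>" by (simp only: floor_less_iff)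
    then have "2 * u - of_int \<lfloor>2 * u\<rfloor> \<le> 2 * - d" by simp
    then have "\<bar>2 * u - of_int \<lfloor>2 * u\<rfloor>\<bar> \<le> 2 * \<bar>d\<bar>"
      using False of_int_floor_le[of "2 * u"] by simp
    then show ?thesis by (rule that)
  qed
qed

lemma S_0 [simp]: "S \<theta> 0 x = 0"
  by (simp add: S_def)

lemma S_add: "S \<theta> (m + n) x = S \<theta> m x + S \<theta> n (x + real m * \<theta>)"
  by (induction n) (simp_all add: S_def algebra_simps)

lemma S_Suc: "S \<theta> (Suc n) x = f_half x + S \<theta> n (x + \<theta>)"
  using S_add[of \<theta> 1 n x] by (simp add: S_def)

lemma S_add_int: "S \<theta> n (x + of_int p) = S \<theta> n x"
proof -
  have "f_half (x + of_int p + t) = f_half (x + t)" for t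
    using f_half_add_int[of "x + t" p] by (simp add: ac_simps)
  then show ?thesis by (simp add: S_def)
qed

lemma S_add_half: "S \<theta> n (x + 1/2) = - S \<theta> n x"
proof -
  have "f_half (x + 1/2 + t) = - f_half (x + t)" for t
    using f_half_add_half[of "x + t"] by (simp add: ac_simps)
  then show ?thesis by (simp add: S_def sum_negf)
qed

text \<open>Every step is 1 or -1. Integrality makes ranges grow in whole units; parity excludes a
  zero sum over an odd number of steps.\<close>

lemma S_parity:
  obtains s :: int where "S \<theta> n x = of_int s" and "even s \<longleftrightarrow> even n"
proof -
  have "\<exists>s::int. S \<theta> n x = of_int s \<and> (even s \<longleftrightarrow> even n)"
  proof (induction n arbitrary: x)
    case (Suc n)
    obtain s :: int where s: "S \<theta> n (x + \<theta>) = of_int s" "even s \<longleftrightarrow> even n"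
      using Suc by blast
    show ?case
    proof (cases "f_half x = 1")
      case True
      then show ?thesis using s by (intro exI[of _ "1 + s"]) (simp add: S_Suc)
    next
      case False
      then have "f_half x = -1" by (auto simp: f_half_floor split: if_splits)
      then show ?thesis using s by (intro exI[of _ "s - 1"]) (simp add: S_Suc)
    qed
  qed (auto intro: exI[of _ 0])
  then show ?thesis using that by blast
qed

section \<open>Lower bound: lengthening the orbit by a constant factor enlarges the range\<close>

section \<open>Lower bound\<close>

lemma range_increase:
  fixes R N q :: nat and p :: int
  assumes c: "0 < c"
    and bad: "\<And>(m::int) (p::int). 0 < m \<Longrightarrow> c / of_int m \<le> \<bar>of_int m * \<theta> - of_int p\<bar>"
    and N: "0 < N" and q: "odd q" and close: "\<bar>real q * \<theta> - of_int p\<bar> < c / (16 * real N)"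
    and range: "\<And>y. \<exists>i\<le>N. \<exists>j\<le>N. real R \<le> S \<theta> i y - S \<theta> j y"
  shows "\<exists>i\<le>2 * N + q. \<exists>j\<le>2 * N + q. real (Suc R) \<le> S \<theta> i y - S \<theta> j y"
proof (rule ccontr)
  assume neg: "\<not> ?thesis"
  \<comment> \<open>Differences of sums are integers, so one below R + 1 is at most R.\<close>
  have osc: "S \<theta> i y - S \<theta> j y \<le> real R" if "i \<le> 2 * N + q" "j \<le> 2 * N + q" for i j
  proof -
    obtain s t :: int where st: "S \<theta> i y = of_int s" "S \<theta> j y = of_int t"
      using S_parity by metis
    have "S \<theta> i y - S \<theta> j y < real (Suc R)" using neg that by force
    then have "real_of_int (s - t) < of_int (int (Suc R))" unfolding st by simp
    then have "s - t \<le> int R" by linarith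
    then show ?thesis unfolding st by linarith
  qed
  \<comment> \<open>A window that realizes the full range R must contain a global maximum: anything
    higher would exceed the window's low point by more than R.\<close>
  have peak: "\<exists>l\<le>N. \<forall>j\<le>2 * N + q. S \<theta> j y \<le> S \<theta> (a + l) y" if a: "a + N \<le> 2 * N + q" for a
  proof -
    obtain i j where ij: "i \<le> N" "j \<le> N"
      "real R \<le> S \<theta> i (y + real a * \<theta>) - S \<theta> j (y + real a * \<theta>)"
      using range by blast
    then have "real R \<le> S \<theta> (a + i) y - S \<theta> (a + j) y" by (simp add: S_add)
    moreover have "S \<theta> j' y - S \<theta> (a + j) y \<le> real R" if "j' \<le> 2 * N + q" for j'
      using osc that ij(2) a by simp
    ultimately have "S \<theta> j' y \<le> S \<theta> (a + i) y" if "j' \<le> 2 * N + q" for j'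
      using that by fastforce
    then show ?thesis using ij(1) by blast
  qed
  \<comment> \<open>With a \<le> N, the translated window from a + q to a + q + N still lies within
    2 N + q.\<close>
  have crossing: "\<exists>l<N. f_half (y + real (a + l) * \<theta>) \<noteq> f_half (y + real (a + l) * \<theta> + real q * \<theta>)"
    if a: "a \<le> N" for a
  proof (rule ccontr)
    assume nc: "\<not> ?thesis"
    define d where "d = S \<theta> (a + q) y - S \<theta> a y"
    have d: "S \<theta> (a + q + l) y = S \<theta> (a + l) y + d" if "l \<le> N" for l
    proof -
      have "S \<theta> l (y + real (a + q) * \<theta>) = S \<theta> l (y + real a * \<theta>)"
        unfolding S_def
      proof (intro sum.cong refl)
        fix i assume "i \<in> {..<l}"
        then have "f_half (y + real (a + i) * \<theta>) = f_half (y + real (a + i) * \<theta> + real q * \<theta>)"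
          using nc that by auto
        then show "f_half (y + real (a + q) * \<theta> + real i * \<theta>) = f_half (y + real a * \<theta> + real i * \<theta>)"
          by (simp add: algebra_simps)
      qed
      then show ?thesis unfolding S_add[of \<theta> "a + q" l] S_add[of \<theta> a l] d_def by simp
    qed
    obtain l where l: "l \<le> N" "\<forall>j\<le>2 * N + q. S \<theta> j y \<le> S \<theta> (a + l) y"
      using peak[of a] a by auto
    have "S \<theta> (a + q + l) y \<le> S \<theta> (a + l) y" using l a by simp
    moreover obtain l' where l': "l' \<le> N" "\<forall>j\<le>2 * N + q. S \<theta> j y \<le> S \<theta> (a + q + l') y"
      using peak[of "a + q"] a by auto
    have "S \<theta> (a + l') y \<le> S \<theta> (a + q + l') y" using l' a by simp
    \<comment> \<open>The peak of the first window gives d \<le> 0, the peak of the second d \<ge>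
      0.\<close>
    ultimately have "d = 0" using d l(1) l'(1) by fastforce
    then have z: "S \<theta> q (y + real a * \<theta>) = 0" unfolding d_def S_add by simp
    obtain s :: int where "S \<theta> q (y + real a * \<theta>) = of_int s" "even s \<longleftrightarrow> even q"
      using S_parity by blast
    then show False using z q by simp
  qed
  let ?\<delta> = "real q * \<theta> - of_int p"
  have near: "\<exists>b::int. \<bar>2 * (y + real i * \<theta>) - of_int b\<bar> \<le> 2 * \<bar>?\<delta>\<bar>"
    if "f_half (y + real i * \<theta>) \<noteq> f_half (y + real i * \<theta> + real q * \<theta>)" for i
  proof -
    have "f_half (y + real i * \<theta> + real q * \<theta>) = f_half (y + real i * \<theta> + ?\<delta>)"
      using f_half_add_int[of "y + real i * \<theta> + ?\<delta>" p] by (simp add: algebra_simps)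
    then show ?thesis using that f_half_neq_imp_near by metis
  qed
  obtain k l where kl: "k < N" "l < N"
    and ne: "f_half (y + real k * \<theta>) \<noteq> f_half (y + real k * \<theta> + real q * \<theta>)"
      "f_half (y + real (N + l) * \<theta>) \<noteq> f_half (y + real (N + l) * \<theta> + real q * \<theta>)"
    using crossing[of 0] crossing[of N] by auto
  obtain a b :: int where ab: "\<bar>2 * (y + real k * \<theta>) - of_int a\<bar> \<le> 2 * \<bar>?\<delta>\<bar>"
    "\<bar>2 * (y + real (N + l) * \<theta>) - of_int b\<bar> \<le> 2 * \<bar>?\<delta>\<bar>"
    using near[OF ne(1)] near[OF ne(2)] by blast
  \<comment> \<open>The factor 2 is there because the discontinuities are the half-integers. Two
    distances of at most 2 \<bar>\<delta>\<bar> and the bound m \<le> 4 N account for the 16 in the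
    hypothesis.\<close>
  define m where "m = 2 * (int (N + l) - int k)"
  have m: "0 < m" "m \<le> 4 * int N" using kl by (auto simp: m_def)
  have "of_int m * \<theta> - of_int (b - a)
      = (2 * (y + real (N + l) * \<theta>) - of_int b) - (2 * (y + real k * \<theta>) - of_int a)"
    by (simp add: m_def algebra_simps)
  then have "\<bar>of_int m * \<theta> - of_int (b - a)\<bar> \<le> 4 * \<bar>?\<delta>\<bar>" using ab by linarith
  also have "\<dots> < c / (4 * real N)" using close by simp
  also have "\<dots> \<le> c / of_int m"
  proof (rule divide_left_mono)
    show "real_of_int m \<le> 4 * real N" using m(2) by linarith
  qed (use c m N in auto)
  finally show False using bad[OF m(1), of "b - a"] by simp
qed

text \<open>Iterates \<open>range_increase\<close> with N = D ^ k, where \<open>D\<close> is large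
  enough that 2 N + q \<le> D N.\<close>

lemma range_power:
  assumes "finite_type \<theta>"
  obtains D :: nat where "3 \<le> D"
    and "\<And>k y. \<exists>i\<le>D ^ k. \<exists>j\<le>D ^ k. real k \<le> S \<theta> i y - S \<theta> j y"
proof -
  obtain c :: real where c: "0 < c"
    and bad: "\<And>(m::int) (p::int). 0 < m \<Longrightarrow> c / of_int m \<le> \<bar>of_int m * \<theta> - of_int p\<bar>"
    using badly_approximable[OF assms] by blast
  obtain C :: real where C: "0 < C"
    and od: "\<And>X. 1 \<le> X \<Longrightarrow> \<exists>q p. odd q \<and> 0 < q \<and> of_int q \<le> C * X \<and> \<bar>of_int q * \<theta> - of_int p\<bar> < 1 / X"
    using odd_denominator[OF assms] by blast
  define D where "D = 3 + nat \<lceil>C * (16 / c + 1)\<rceil>"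
  have D: "2 + C * (16 / c + 1) \<le> real D"
    unfolding D_def using real_nat_ceiling_ge[of "C * (16 / c + 1)"] by simp
  have step: "\<exists>q p. odd q \<and> 2 * N + q \<le> D * N \<and> \<bar>real q * \<theta> - of_int p\<bar> < c / (16 * real N)"
    if N: "0 < N" for N :: nat
  proof -
    \<comment> \<open>The summand 1 guarantees 1 \<le> X; for N \<ge> 1 it is absorbed into (16 / c
      + 1) N.\<close>
    define X where "X = 16 * real N / c + 1"
    have X: "1 \<le> X" using c by (simp add: X_def)
    obtain q p :: int where qp: "odd q" "0 < q" "of_int q \<le> C * X" "\<bar>of_int q * \<theta> - of_int p\<bar> < 1 / X"
      using od[OF X] by blast
    have "1 / X < c / (16 * real N)"
      using c N X by (simp add: X_def field_simps)
    then have close: "\<bar>real (nat q) * \<theta> - of_int p\<bar> < c / (16 * real N)" using qp(2,4) by simp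
    have "X \<le> (16 / c + 1) * real N" using N by (simp add: X_def algebra_simps)
    then have "C * X \<le> C * ((16 / c + 1) * real N)" using C by (intro mult_left_mono) auto
    then have "2 * real N + real (nat q) \<le> (2 + C * (16 / c + 1)) * real N"
      using qp(2,3) by (simp add: algebra_simps)
    also have "\<dots> \<le> real D * real N" using D by (intro mult_right_mono) auto
    finally have "real (2 * N + nat q) \<le> real (D * N)" by simp
    then have "2 * N + nat q \<le> D * N" by (simp only: of_nat_le_iff)
    moreover have "odd (nat q)" using qp(1,2) by (simp add: even_nat_iff)
    ultimately show ?thesis using close by blast
  qed
  have "\<exists>i\<le>D ^ k. \<exists>j\<le>D ^ k. real k \<le> S \<theta> i y - S \<theta> j y" for k y
  proof (induction k arbitrary: y)
    case 0
    have "S \<theta> 0 y - S \<theta> 0 y = 0" by simp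
    then show ?case by (metis le0 of_nat_0 order_refl)
  next
    case (Suc k)
    have pos: "0 < D ^ k" by (simp add: D_def)
    obtain q p where q: "odd q" "2 * D ^ k + q \<le> D ^ Suc k"
      "\<bar>real q * \<theta> - of_int p\<bar> < c / (16 * real (D ^ k))"
      using step[OF pos] by auto
    show ?case
      using range_increase[OF c bad pos q(1,3) Suc.IH, of y] q(2) by (meson order_trans)
  qed
  then show ?thesis using that[of D] by (simp add: D_def)
qed

section \<open>Upper bound: sums at denominators and logarithmic growth\<close>

section \<open>Upper bound\<close>

text \<open>Elements at distance at least \<open>g\<close> fall into different blocks of length
  \<open>g\<close>.\<close>

lemma card_separated_le:
  fixes T :: "nat set" and g :: real
  assumes g: "0 < g" and T: "T \<subseteq> {..<n}"
    and sep: "\<And>i j. \<lbrakk>i \<in> T; j \<in> T; i < j\<rbrakk> \<Longrightarrow> g \<le> real j - real i"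
  shows "real (card T) \<le> real n / g + 1"
proof -
  let ?h = "\<lambda>i. nat \<lfloor>real i / g\<rfloor>"
  have lt: "?h i < ?h j" if "i \<in> T" "j \<in> T" "i < j" for i j
  proof -
    have "(real i + g) / g \<le> real j / g" using sep[OF that] g by (intro divide_right_mono) auto
    then have "real i / g + 1 \<le> real j / g" using g by (simp add: add_divide_distrib)
    then have "\<lfloor>real i / g\<rfloor> + 1 \<le> \<lfloor>real j / g\<rfloor>" by linarith
    moreover have "0 \<le> \<lfloor>real i / g\<rfloor>" using g by simp
    ultimately show ?thesis by linarith
  qed
  have "inj_on ?h T"
    by (rule inj_onI) (metis lt less_irrefl linorder_neqE_nat)
  moreover have "?h ` T \<subseteq> {..nat \<lfloor>real n / g\<rfloor>}"
  proof (rule image_subsetI)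
    fix i assume "i \<in> T"
    then have "real i / g \<le> real n / g" using T g by (intro divide_right_mono) auto
    then show "?h i \<in> {..nat \<lfloor>real n / g\<rfloor>}" by (simp add: floor_mono nat_mono)
  qed
  ultimately have "card T \<le> card {..nat \<lfloor>real n / g\<rfloor>}"
    by (intro card_inj_on_le) auto
  then have "card T \<le> nat \<lfloor>real n / g\<rfloor> + 1" by simp
  then have "real (card T) \<le> real (nat \<lfloor>real n / g\<rfloor>) + 1" by linarith
  also have "real (nat \<lfloor>real n / g\<rfloor>) \<le> real n / g" using g by simp
  finally show ?thesis by simp
qed

text \<open>A summand changes only if its point is close to a discontinuity. Two such indices i < j
  bring 2 (j - i) \<theta> within 4 \<bar>d\<bar> of an integer, so they are at least c / (8
  \<bar>d\<bar>) apart; each contributes at most 2.\<close>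

lemma S_translate_le:
  assumes c: "0 < c"
    and bad: "\<And>(m::int) (p::int). 0 < m \<Longrightarrow> c / of_int m \<le> \<bar>of_int m * \<theta> - of_int p\<bar>"
  shows "\<bar>S \<theta> n (y + d) - S \<theta> n y\<bar> \<le> 16 * (real n * \<bar>d\<bar>) / c + 2"
\<comment> \<open>For d = 0 the gap \<open>g\<close> would be a division by zero, hence 0.\<close>
proof (cases "d = 0")
  case True
  then show ?thesis using c by simp
next
  case False
  define T where "T = {i. i < n \<and> f_half (y + real i * \<theta>) \<noteq> f_half (y + real i * \<theta> + d)}"
  have T: "T \<subseteq> {..<n}" by (auto simp: T_def)
  define g where "g = c / (8 * \<bar>d\<bar>)"
  have "g \<le> real j - real i" if ij: "i \<in> T" "j \<in> T" "i < j" for i j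
  proof -
    obtain a b :: int where ab: "\<bar>2 * (y + real i * \<theta>) - of_int a\<bar> \<le> 2 * \<bar>d\<bar>"
      "\<bar>2 * (y + real j * \<theta>) - of_int b\<bar> \<le> 2 * \<bar>d\<bar>"
      using ij(1,2) f_half_neq_imp_near unfolding T_def mem_Collect_eq by metis
    define m where "m = 2 * (int j - int i)"
    have m: "0 < m" using ij(3) by (simp add: m_def)
    have "of_int m * \<theta> - of_int (b - a)
        = (2 * (y + real j * \<theta>) - of_int b) - (2 * (y + real i * \<theta>) - of_int a)"
      by (simp add: m_def algebra_simps)
    then have "\<bar>of_int m * \<theta> - of_int (b - a)\<bar> \<le> 4 * \<bar>d\<bar>" using ab by linarith
    with bad[OF m, of "b - a"] have "c / of_int m \<le> 4 * \<bar>d\<bar>" by linarith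
    then have "c \<le> 4 * \<bar>d\<bar> * of_int m" using m by (simp add: pos_divide_le_eq)
    then show ?thesis using False by (simp add: g_def m_def field_simps)
  qed
  then have card: "real (card T) \<le> real n / g + 1"
    using card_separated_le[OF _ T, of g] c False by (simp add: g_def)
  have "S \<theta> n (y + d) - S \<theta> n y = (\<Sum>i<n. f_half (y + real i * \<theta> + d) - f_half (y + real i * \<theta>))"
    by (simp add: S_def sum_subtractf add_ac)
  also have "\<bar>\<dots>\<bar> \<le> (\<Sum>i<n. \<bar>f_half (y + real i * \<theta> + d) - f_half (y + real i * \<theta>)\<bar>)"
    by (rule sum_abs)
  also have "\<dots> \<le> (\<Sum>i<n. if i \<in> T then 2 else 0)"
    by (intro sum_mono) (auto simp: T_def f_half_floor)
  also have "\<dots> = 2 * real (card T)"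
    using T by (simp add: sum.If_cases Int_absorb1)
  also have "\<dots> \<le> 2 * (real n / g + 1)" using card by simp
  also have "\<dots> = 16 * (real n * \<bar>d\<bar>) / c + 2" using c False by (simp add: g_def field_simps)
  finally show ?thesis .
qed

text \<open>A substitute for the Denjoy--Koksma inequality: some \<open>j \<theta>\<close> with \<open>j < q\<close> is within \<open>2 / q\<close>
  of \<open>1 / 2\<close> modulo one. Translating by \<open>j \<theta>\<close> changes \<open>S \<theta> q\<close> little because \<open>q \<theta>\<close> is close
  to an integer, whereas translating by \<open>1 / 2\<close> changes its sign.\<close>

lemma S_denominator_bounded:
  fixes q :: nat and p :: int
  assumes c: "0 < c"
    and bad: "\<And>(m::int) (p::int). 0 < m \<Longrightarrow> c / of_int m \<le> \<bar>of_int m * \<theta> - of_int p\<bar>"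
    and q: "0 < q" and cop: "coprime p (int q)" and close: "\<bar>real q * \<theta> - of_int p\<bar> \<le> 1 / real q"
  shows "\<bar>S \<theta> q y\<bar> \<le> 24 / c + 2"
proof -
  obtain x :: int where x: "[p * x = 1] (mod int q)"
    using cong_solve_coprime_int[OF cop] by blast
  \<comment> \<open>\<open>j\<close> solves p j = h modulo q with h about q / 2, so j p / q, and
    with it j \<theta>, is close to 1/2 modulo one.\<close>
  define h where "h = int q div 2"
  define j where "j = nat (x * h mod int q)"
  have j: "int j = x * h mod int q" "j < q" using q by (auto simp: j_def nat_less_iff)
  have "[p * int j = p * (x * h)] (mod int q)"
    unfolding j(1) by (intro cong_mult cong_refl) (simp add: cong_def)
  also have "[p * (x * h) = 1 * h] (mod int q)"
    unfolding mult.assoc[symmetric] by (intro cong_mult x cong_refl)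
  finally have "[h = p * int j] (mod int q)" by (simp add: cong_sym)
  then obtain t where t: "p * int j = h + int q * t"
    unfolding cong_iff_lin by blast
  define e where "e = real q * \<theta> - of_int p"
  define d where "d = real j * \<theta> - 1/2 - of_int t"
  have "real q * d = real j * e + of_int h - real q / 2"
  proof -
    have "of_int p * real j = of_int h + real q * of_int t"
      using arg_cong[OF t, of real_of_int] by simp
    then show ?thesis unfolding d_def e_def by (simp add: algebra_simps)
  qed
  moreover have "\<bar>real j * e\<bar> \<le> 1"
  proof -
    have "real j * \<bar>e\<bar> \<le> real q * (1 / real q)"
      using j(2) close unfolding e_def by (intro mult_mono) auto
    then show ?thesis using q by (simp add: abs_mult)
  qed
  moreover have "\<bar>of_int h - real q / 2\<bar> \<le> 1" unfolding h_def by linarith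
  ultimately have "\<bar>real q * d\<bar> \<le> 2" by linarith
  then have qd: "real q * \<bar>d\<bar> \<le> 2" by (simp add: abs_mult)
  have je: "real j * \<bar>e\<bar> \<le> 1" using \<open>\<bar>real j * e\<bar> \<le> 1\<close> by (simp add: abs_mult)

  have "S \<theta> q (y + real j * \<theta>) = S \<theta> q (y + 1/2 + d + of_int t)"
    by (simp add: d_def)
  then have half: "S \<theta> q (y + real j * \<theta>) = S \<theta> q (y + 1/2 + d)"
    by (simp only: S_add_int)
  have "\<bar>S \<theta> q (y + 1/2 + d) - S \<theta> q (y + 1/2)\<bar> \<le> 16 * (real q * \<bar>d\<bar>) / c + 2"
    by (rule S_translate_le[OF c bad])
  also have "\<dots> \<le> 16 * 2 / c + 2"
    using qd c by (intro add_mono divide_right_mono mult_left_mono) auto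
  finally have 1: "\<bar>S \<theta> q (y + real j * \<theta>) + S \<theta> q y\<bar> \<le> 32 / c + 2"
    unfolding half S_add_half by simp

  have "S \<theta> j (y + real q * \<theta>) = S \<theta> j (y + e + of_int p)" by (simp add: e_def)
  then have "S \<theta> j (y + real q * \<theta>) = S \<theta> j (y + e)" by (simp only: S_add_int)
  \<comment> \<open>Splitting the sum of length q + j in both orders exchanges a shift by j \<theta>
    of the long sum for a shift by q \<theta> of the short one.\<close>
  then have "S \<theta> q (y + real j * \<theta>) - S \<theta> q y = S \<theta> j (y + e) - S \<theta> j y"
    using S_add[of \<theta> q j y] S_add[of \<theta> j q y] by (simp add: add.commute)
  moreover have "\<bar>S \<theta> j (y + e) - S \<theta> j y\<bar> \<le> 16 * (real j * \<bar>e\<bar>) / c + 2"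
    by (rule S_translate_le[OF c bad])
  moreover have "\<dots> \<le> 16 * 1 / c + 2"
    using je c by (intro add_mono divide_right_mono mult_left_mono) auto
  ultimately have 2: "\<bar>S \<theta> q (y + real j * \<theta>) - S \<theta> q y\<bar> \<le> 16 / c + 2" by simp
  \<comment> \<open>The shifted sum is nearly both -S and S, where S is the sum at \<open>y\<close>;
    subtracting eliminates it.\<close>
  have "\<bar>2 * S \<theta> q y\<bar> \<le> (32 / c + 2) + (16 / c + 2)" using 1 2 by linarith
  then show ?thesis by simp
qed

lemma S_log_bound:
  assumes "finite_type \<theta>"
  obtains K L :: real where "0 \<le> K" "0 \<le> L"
    and "\<And>n y. 1 \<le> n \<Longrightarrow> \<bar>S \<theta> n y\<bar> \<le> K + L * ln (real n)"
proof -
  have irr: "\<theta> \<notin> \<rat>" using assms by (simp add: finite_type_def)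
  obtain c :: real where c: "0 < c"
    and bad: "\<And>(m::int) (p::int). 0 < m \<Longrightarrow> c / of_int m \<le> \<bar>of_int m * \<theta> - of_int p\<bar>"
    using badly_approximable[OF assms] by blast
  obtain B :: real where B: "2 \<le> B"
    "\<And>k. of_int (conv_den \<theta> (Suc (Suc k))) \<le> B * of_int (conv_den \<theta> (Suc k))"
    using conv_den_growth[OF assms] by blast
  define K where "K = 24 / c + 2"
  define \<mu> where "\<mu> = 1 - 1 / B"
  \<comment> \<open>Chosen so that shrinking n by the factor \<mu> lowers L ln n by exactly K, the
    cost of the denominator block that is peeled off.\<close>
  define L where "L = K / - ln \<mu>"
  have K: "0 \<le> K" using c by (simp add: K_def)
  have \<mu>: "0 < \<mu>" "\<mu> < 1" using B(1) by (auto simp: \<mu>_def)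
  then have ln\<mu>: "ln \<mu> < 0" by simp
  have L: "0 \<le> L" unfolding L_def using K ln\<mu> by (intro divide_nonneg_pos) auto
  have Lln: "L * ln \<mu> = - K" using ln\<mu> by (simp add: L_def)
  have "\<bar>S \<theta> n y\<bar> \<le> K + L * ln (real n)" if "1 \<le> n" for n y
    using that
  proof (induction n arbitrary: y rule: less_induct)
    case (less n)
    obtain k where k: "of_int (conv_den \<theta> (Suc k)) \<le> real n"
        "real n < of_int (conv_den \<theta> (Suc (Suc k)))"
      using conv_den_bracket[OF irr, of "real n"] less.prems by auto
    define q where "q = nat (conv_den \<theta> (Suc k))"
    have q: "0 < q" "conv_den \<theta> (Suc k) = int q"
      using conv_den_pos[OF irr, of k] by (auto simp: q_def)
    have qn: "q \<le> n" using k(1) unfolding q(2) by simp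
    have "\<bar>real q * \<theta> - of_int (conv_num \<theta> (Suc k))\<bar> = conv_err \<theta> (Suc k)"
      using abs_conv_err[OF irr, of "Suc k"] unfolding q(2) by simp
    also have "\<dots> \<le> conv_err \<theta> k" by (rule conv_err_le_Suc[OF irr])
    also have "\<dots> \<le> 1 / real q" using conv_err_upper[OF irr, of k] unfolding q(2) by simp
    finally have Sq: "\<bar>S \<theta> q y\<bar> \<le> K"
      using S_denominator_bounded[OF c bad q(1)] coprime_conv[of \<theta> "Suc k"] unfolding q(2) K_def
      by blast
    show ?case
    proof (cases "q = n")
      case True
      moreover have "0 \<le> L * ln (real n)" using L less.prems by simp
      ultimately show ?thesis using Sq by simp
    next
      case False
      have "real n \<le> B * real q" using k(2) B(2)[of k] unfolding q(2) by simp
      then have "real n / B \<le> real q" using B(1) by (simp add: pos_divide_le_eq mult.commute)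
      then have le: "real (n - q) \<le> \<mu> * real n" using qn by (simp add: \<mu>_def algebra_simps of_nat_diff)
      have "\<bar>S \<theta> (n - q) (y + real q * \<theta>)\<bar> \<le> K + L * ln (real (n - q))"
        using False qn q(1) by (intro less.IH) auto
      also have "\<dots> \<le> K + L * ln (\<mu> * real n)"
        using le False qn L by (intro add_mono mult_left_mono order_refl) auto
      also have "\<dots> = L * ln (real n)"
        using \<mu>(1) less.prems Lln by (simp add: ln_mult distrib_left)
      finally have "\<bar>S \<theta> (n - q) (y + real q * \<theta>)\<bar> \<le> L * ln (real n)" .
      moreover have "S \<theta> n y = S \<theta> q y + S \<theta> (n - q) (y + real q * \<theta>)"
        using S_add[of \<theta> q "n - q" y] qn by simp
      ultimately show ?thesis using Sq by linarith
    qed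
  qed
  then show ?thesis using that K L by blast
qed

section \<open>From the range of the sums to \<rho> and the comparison with ln n\<close>

section \<open>The range of the walk\<close>

lemma \<rho>_ge:
  assumes "i \<in> {1..n - 1}" "j \<in> {1..n - 1}"
  shows "S \<theta> i x - S \<theta> j x + 1 \<le> \<rho> \<theta> n x"
proof -
  have "S \<theta> i x \<le> M_max \<theta> n x" "m_min \<theta> n x \<le> S \<theta> j x"
    using assms by (auto simp: M_max_def m_min_def)
  then show ?thesis by (simp add: \<rho>_def)
qed

lemma \<rho>_le:
  assumes "2 \<le> n" and "\<And>i. i \<in> {1..n - 1} \<Longrightarrow> \<bar>S \<theta> i x\<bar> \<le> b"
  shows "\<rho> \<theta> n x \<le> 2 * b + 1"
proof -
  have "M_max \<theta> n x \<in> (\<lambda>i. S \<theta> i x) ` {1..n - 1}" "m_min \<theta> n x \<in> (\<lambda>i. S \<theta> i x) ` {1..n - 1}"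
    unfolding M_max_def m_min_def using assms(1) by (intro Max_in Min_in; simp)+
  then have "\<bar>M_max \<theta> n x\<bar> \<le> b" "\<bar>m_min \<theta> n x\<bar> \<le> b" using assms(2) by auto
  then show ?thesis by (simp add: \<rho>_def)
qed

theorem theorem1p4:
  fixes \<theta> :: real
  assumes "0 < \<theta>" and "\<theta> < 1" and "finite_type \<theta>"
  shows "\<forall>x. 0 \<le> x \<and> x < 1 \<longrightarrow>
    (\<exists>c C. 0 < c \<and> (\<forall>n\<ge>2. c \<le> \<rho> \<theta> n x / ln (real n) \<and> \<rho> \<theta> n x / ln (real n) \<le> C))"
proof (intro allI impI)
  fix x :: real
  obtain D :: nat where D: "3 \<le> D"
    and grow: "\<And>k y. \<exists>i\<le>D ^ k. \<exists>j\<le>D ^ k. real k \<le> S \<theta> i y - S \<theta> j y"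
    using range_power[OF assms(3)] by blast
  obtain K L :: real where K: "0 \<le> K" and L: "0 \<le> L"
    and up: "\<And>n y. 1 \<le> n \<Longrightarrow> \<bar>S \<theta> n y\<bar> \<le> K + L * ln (real n)"
    using S_log_bound[OF assms(3)] by blast
  \<comment> \<open>For D ^ k \<le> n < D ^ (k + 1), \<rho> is at least (k + 1) / 2 while ln n is at
    most (k + 1) ln D.\<close>
  define c where "c = 1 / (2 * ln (real D))"
  \<comment> \<open>The additive constant 2 K + 1 is absorbed using ln n \<ge> ln 2.\<close>
  define C where "C = (2 * K + 1) / ln 2 + 2 * L"
  have lnD: "0 < ln (real D)" using D by simp
  have "c \<le> \<rho> \<theta> n x / ln (real n) \<and> \<rho> \<theta> n x / ln (real n) \<le> C" if n: "2 \<le> n" for n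
  proof
    have lnn: "0 < ln (real n)" using n by simp
    obtain k where k: "D ^ k \<le> n" "n < D ^ (k + 1)"
      using ex_power_ivl1[of D n] D n by auto
    have "real n \<le> real D ^ (k + 1)" using k(2) by (metis less_imp_le of_nat_le_iff of_nat_power)
    then have "ln (real n) \<le> ln (real D ^ (k + 1))" using n D by (subst ln_le_cancel_iff) auto
    also have "\<dots> = (real k + 1) * ln (real D)" using D by (subst ln_realpow) auto
    finally have ln_le: "ln (real n) \<le> (real k + 1) * ln (real D)" .
    have "(real k + 1) / 2 \<le> \<rho> \<theta> n x"
    proof (cases k)
      case 0
      then show ?thesis using \<rho>_ge[of 1 n 1 \<theta> x] n by fastforce
    next
      case (Suc l)
      \<comment> \<open>The maximum and minimum omit the index 0, so the walk is started at x +
        \<theta>; the common first step f(x) cancels in the difference.\<close>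
      obtain i j where ij: "i \<le> D ^ l" "j \<le> D ^ l" "real l \<le> S \<theta> i (x + \<theta>) - S \<theta> j (x + \<theta>)"
        using grow by blast
      \<comment> \<open>One power of D is given up to make room: D ^ l + 2 \<le> 3 * D ^ l \<le> n
        puts the shifted indices at most at n - 1.\<close>
      have "3 * D ^ l \<le> n" using k(1) D Suc by (auto intro: order_trans[rotated])
      moreover have "1 \<le> D ^ l" using D by simp
      ultimately have "Suc i \<in> {1..n - 1}" "Suc j \<in> {1..n - 1}" using ij by auto
      then have "S \<theta> (Suc i) x - S \<theta> (Suc j) x + 1 \<le> \<rho> \<theta> n x" by (rule \<rho>_ge)
      then show ?thesis using ij(3) Suc by (simp add: S_Suc)
    qed
    moreover have "c * ln (real n) \<le> (real k + 1) / 2"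
      using ln_le lnD by (simp add: c_def field_simps)
    ultimately show "c \<le> \<rho> \<theta> n x / ln (real n)" using lnn by (simp add: pos_le_divide_eq)
    have "\<rho> \<theta> n x \<le> 2 * (K + L * ln (real n)) + 1"
    proof (rule \<rho>_le[OF n])
      fix i assume i: "i \<in> {1..n - 1}"
      then have "\<bar>S \<theta> i x\<bar> \<le> K + L * ln (real i)" by (intro up) simp
      also have "\<dots> \<le> K + L * ln (real n)" using i L by (intro add_mono mult_left_mono) auto
      finally show "\<bar>S \<theta> i x\<bar> \<le> K + L * ln (real n)" .
    qed
    also have "\<dots> \<le> (2 * K + 1) / ln 2 * ln (real n) + 2 * L * ln (real n)"
    proof -
      have "(2 * K + 1) / ln 2 * ln 2 \<le> (2 * K + 1) / ln 2 * ln (real n)"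
        using n K by (intro mult_left_mono) auto
      moreover have "(2 * K + 1) / ln 2 * ln 2 = 2 * K + 1" by simp
      ultimately have "2 * K + 1 \<le> (2 * K + 1) / ln 2 * ln (real n)" by linarith
      then show ?thesis by (simp add: distrib_left)
    qed
    also have "\<dots> = C * ln (real n)" by (simp add: C_def algebra_simps)
    finally show "\<rho> \<theta> n x / ln (real n) \<le> C" using lnn by (simp add: pos_divide_le_eq)
  qed
  moreover have "0 < c" using lnD by (simp add: c_def)
  ultimately show "\<exists>c C. 0 < c \<and> (\<forall>n\<ge>2. c \<le> \<rho> \<theta> n x / ln (real n) \<and> \<rho> \<theta> n x / ln (real n) \<le> C)"
    by blast
qed

end
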